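(* Let $0<\delta<\frac12$, $\beta>1$, and $h\in\mathbb{R}$ with $h\neq0$. Then for every $\alpha>0$, $$\lim_{n\to\infty} n^{\alpha}\,\pi^n\left(\{x\in\{-1,1\}^n:\ \eta^n(x)\notin F^{n,\delta}\}\right)=0,$$ where $\pi^n$ is the Curie-Weiss measure on $\{-1,1\}^n$ with parameters $\beta,h$, $\eta^n$ is the centered and scaled magnetization, and $F^{n,\delta}=\{\eta\in X^n:|\eta|\le n^{\delta}\}$.
   Context: Curie-Weiss model: for $n\ge 1$, $\beta>0$, $h\in\mathbb{R}$, let $\pi^n$ be the probability measure on $\{-1,1\}^n$ given by $\pi^n(x)=\exp[-\beta H^n(x)]/Z_n$, where $Z_n$ is the normalizing constant, $m^n(x)=\frac1n\sum_{i=1}^n x_i$ is the magnetization, and $H^n(x)=-n\left[\frac12 (m^n(x))^2+h\,m^n(x)\right]$. For $\beta>1$ and $h\ne 0$, $m_0=m_0(h,\beta)$ denotes the unique global minimum point over $m\in(-1,1)$ of $$-\left(\tfrac12\beta m^2+\beta h m\right)+\tfrac{1-m}{2}\log(1-m)+\tfrac{1+m}{2}\log(1+m).$$ It satisfies $m_0=\tanh(\beta(m_0+h))$. The centered and scaled magnetization is $\eta^n(x)=n^{1/2}[m^n(x)-m_0]$, $x\in\{-1,1\}^n$, and $X^n=\eta^n(\{-1,1\}^n)$ is the set of its possible values. *)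

theory Defs
  imports "HOL-Probability.Probability"
begin

(* The set {-1,1}^n.  The dimension n varies inside the statement, so a configuration is a
   function on nat that is extensional outside the index set {1..n}. *)
definition spin_configs :: "nat \<Rightarrow> (nat \<Rightarrow> real) set" where
  "spin_configs n = {1..n} \<rightarrow>\<^sub>E {-1, 1}"

definition magnetization :: "nat \<Rightarrow> (nat \<Rightarrow> real) \<Rightarrow> real" where
  "magnetization n x = (1 / real n) * (\<Sum>i = 1..n. x i)"

definition hamiltonian :: "real \<Rightarrow> nat \<Rightarrow> (nat \<Rightarrow> real) \<Rightarrow> real" where
  "hamiltonian h n x = - real n * ((1 / 2) * (magnetization n x)\<^sup>2 + h * magnetization n x)"

definition partition_function :: "real \<Rightarrow> real \<Rightarrow> nat \<Rightarrow> real" where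
  "partition_function \<beta> h n = (\<Sum>x\<in>spin_configs n. exp (- \<beta> * hamiltonian h n x))"

definition curie_weiss :: "real \<Rightarrow> real \<Rightarrow> nat \<Rightarrow> (nat \<Rightarrow> real) measure" where
  "curie_weiss \<beta> h n = point_measure (spin_configs n)
     (\<lambda>x. ennreal (exp (- \<beta> * hamiltonian h n x) / partition_function \<beta> h n))"

definition free_energy :: "real \<Rightarrow> real \<Rightarrow> real \<Rightarrow> real" where
  "free_energy \<beta> h m = - ((1 / 2) * \<beta> * m\<^sup>2 + \<beta> * h * m)
     + (1 - m) / 2 * ln (1 - m) + (1 + m) / 2 * ln (1 + m)"

(* Meaningful only where the global minimum point is unique, in particular for
   \<beta> > 1 and h \<noteq> 0. *)
definition m0 :: "real \<Rightarrow> real \<Rightarrow> real" where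
  "m0 \<beta> h = (THE m. is_arg_min (free_energy \<beta> h) (\<lambda>m. m \<in> {-1<..<1}) m)"

definition scaled_magnetization :: "real \<Rightarrow> real \<Rightarrow> nat \<Rightarrow> (nat \<Rightarrow> real) \<Rightarrow> real" where
  "scaled_magnetization \<beta> h n x = sqrt (real n) * (magnetization n x - m0 \<beta> h)"

definition scaled_values :: "real \<Rightarrow> real \<Rightarrow> nat \<Rightarrow> real set" where
  "scaled_values \<beta> h n = scaled_magnetization \<beta> h n ` spin_configs n"

definition F_set :: "real \<Rightarrow> real \<Rightarrow> nat \<Rightarrow> real \<Rightarrow> real set" where
  "F_set \<beta> h n \<delta> = {\<eta> \<in> scaled_values \<beta> h n. \<bar>\<eta>\<bar> \<le> real n powr \<delta>}"

lemma finite_spin_configs: "finite (spin_configs n)"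
  unfolding spin_configs_def by (intro finite_PiE) auto

lemma spin_configs_nonempty: "spin_configs n \<noteq> {}"
  by (simp add: spin_configs_def PiE_eq_empty_iff)

lemma partition_function_pos: "partition_function \<beta> h n > 0"
  unfolding partition_function_def
  by (intro sum_pos finite_spin_configs spin_configs_nonempty) simp

lemma prob_space_curie_weiss: "prob_space (curie_weiss \<beta> h n)"
proof (rule prob_spaceI)
  have "emeasure (curie_weiss \<beta> h n) (spin_configs n)
      = (\<Sum>x\<in>spin_configs n. ennreal (exp (- \<beta> * hamiltonian h n x) / partition_function \<beta> h n))"
    unfolding curie_weiss_def
    by (rule emeasure_point_measure_finite) (simp_all add: finite_spin_configs)
  also have "\<dots> = ennreal (\<Sum>x\<in>spin_configs n. exp (- \<beta> * hamiltonian h n x) / partition_function \<beta> h n)"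
    by (rule sum_ennreal) (simp add: partition_function_pos less_imp_le)
  also have "(\<Sum>x\<in>spin_configs n. exp (- \<beta> * hamiltonian h n x) / partition_function \<beta> h n) = 1"
    using partition_function_pos[of \<beta> h n]
    by (simp only: sum_divide_distrib[symmetric] partition_function_def[symmetric]) simp
  finally show "emeasure (curie_weiss \<beta> h n) (space (curie_weiss \<beta> h n)) = 1"
    by (simp add: curie_weiss_def space_point_measure)
qed

end

theory Submission
  imports Defs "HOL-Real_Asymp.Real_Asymp"
begin

text \<open>
  Write \<open>f\<close> for the free energy, \<open>I\<close> for its entropic part, so that
  \<open>f m = I m - \<beta> * m\<^sup>2 / 2 - \<beta> * h * m\<close>, and \<open>p = m0 \<beta> h\<close>.  The theorem follows from the bound,
  valid for every \<open>n \<ge> 1\<close> and \<open>r\<close>,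
  \<open>\<pi>\<^sup>n {x. n * (m\<^sup>n x - p)\<^sup>2 \<ge> r} \<le> (n + 1) * exp (- c * r)\<close> with \<open>c = \<beta> * h / (2 * p) > 0\<close>:
  taking \<open>r = n powr (2 * \<delta>)\<close> gives a stretched exponential, which beats every power of \<open>n\<close>.

  The bound has an analytic and a combinatorial half.  The analytic half is the global quadratic
  estimate \<open>f m \<ge> f p + c * (m - p)\<^sup>2\<close> on \<open>{-1..1}\<close>.  It holds because \<open>I\<close> is a convex function of
  \<open>m\<^sup>2\<close> (\<open>cramer_rate_ge_tangent_parabola\<close>): the tangent, in the variable \<open>m\<^sup>2\<close>, at a solution \<open>p\<close> of
  the mean-field equation \<open>artanh p = \<beta> * (p + h)\<close> is a parabola touching \<open>I\<close> at \<open>p\<close> and \<open>-p\<close>,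
  and subtracting the energy from it leaves exactly \<open>f p + c * (m - p)\<^sup>2\<close>.  If moreover \<open>p\<close> has the
  sign of \<open>h\<close>, then \<open>c > 0\<close>, so that \<open>p\<close> is the unique minimum point.

  The combinatorial half avoids binomial coefficients and Stirling's formula by comparing with
  the product measures \<open>q\<^sub>t\<close> of \<open>n\<close> coins with mean \<open>t\<close>.  The density of \<open>q\<^sub>t\<close> depends on \<open>x\<close> only
  through its magnetization \<open>m\<close>, and for \<open>t = m\<close> it equals \<open>exp (n * I m) / 2 ^ n\<close>.  Hence the
  Boltzmann weight of \<open>x\<close> is \<open>2 ^ n * exp (- n * f m) * q\<^sub>m x\<close>, and since each \<open>q\<^sub>t\<close> has total mass 1
  and there are at most \<open>n + 1\<close> values of \<open>m\<close>, the bad configurations have total weight at most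
  \<open>(n + 1) * 2 ^ n * exp (- n * f p - c * r)\<close>.  Conversely, the partition function is at least
  \<open>2 ^ n * exp (- n * f p)\<close>, by comparing the Boltzmann weight with \<open>q\<^sub>p\<close> alone.
\<close>

section \<open>The entropy of a biased coin\<close>

definition cramer_rate :: "real \<Rightarrow> real" where
  "cramer_rate m = (1 - m) / 2 * ln (1 - m) + (1 + m) / 2 * ln (1 + m)"

lemma free_energy_eq_cramer_rate:
  "free_energy \<beta> h m = cramer_rate m - (\<beta> * m\<^sup>2 / 2 + \<beta> * h * m)"
  by (simp add: free_energy_def cramer_rate_def)

lemma cramer_rate_minus [simp]: "cramer_rate (- m) = cramer_rate m"
  by (simp add: cramer_rate_def)

lemma artanh_eq_ln_diff:
  fixes t :: real
  assumes "\<bar>t\<bar> < 1"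
  shows "artanh t = (ln (1 + t) - ln (1 - t)) / 2"
proof -
  have "1 + t > 0" "1 - t > 0" using assms by auto
  then show ?thesis by (simp add: artanh_def ln_div)
qed

lemma cramer_rate_has_real_derivative:
  assumes "\<bar>m\<bar> < 1"
  shows "(cramer_rate has_real_derivative artanh m) (at m)"
proof -
  have pos: "1 - m > 0" "1 + m > 0" using assms by auto
  have "((\<lambda>u. u / 2 * ln u) has_real_derivative (ln u + 1) / 2) (at u)" if "u > 0" for u :: real
    using that by (auto intro!: derivative_eq_intros simp: field_simps)
  then have "((\<lambda>m. (1 - m) / 2 * ln (1 - m) + (1 + m) / 2 * ln (1 + m)) has_real_derivative
      (ln (1 - m) + 1) / 2 * - 1 + (ln (1 + m) + 1) / 2 * 1) (at m)"
    using pos by (intro DERIV_add DERIV_chain2[where f = "\<lambda>u. u / 2 * ln u"])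
      (auto intro!: derivative_eq_intros)
  then show ?thesis
    unfolding cramer_rate_def[abs_def] artanh_eq_ln_diff[OF assms] by (simp add: field_simps)
qed

lemma continuous_on_mult_ln_self: "continuous_on {0..} (\<lambda>u::real. u * ln u)"
proof (rule continuous_on_eq_continuous_within[THEN iffD2], intro ballI)
  fix u :: real assume u: "u \<in> {0..}"
  show "continuous (at u within {0..}) (\<lambda>u. u * ln u)"
  proof (cases "u = 0")
    case True
    have "((\<lambda>u::real. u * ln u) \<longlongrightarrow> 0) (at_right 0)"
      by real_asymp
    then show ?thesis
      using True by (simp add: continuous_within at_within_Ici_at_right)
  next
    case False
    then show ?thesis using u
      by (intro continuous_intros) auto
  qed
qed

lemma continuous_on_cramer_rate: "continuous_on {-1..1} cramer_rate"
proof -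
  have "continuous_on {-1..1} (\<lambda>m. ((1 - m) * ln (1 - m) + (1 + m) * ln (1 + m)) / (2::real))"
    by (intro continuous_intros continuous_on_compose2[OF continuous_on_mult_ln_self]) auto
  moreover have "(\<lambda>m. ((1 - m) * ln (1 - m) + (1 + m) * ln (1 + m)) / 2) = cramer_rate"
    by (auto simp: cramer_rate_def fun_eq_iff field_simps)
  ultimately show ?thesis by metis
qed

text \<open>
  A convex function vanishing at 0 has increasing slopes \<open>artanh x / x\<close>; since \<open>cramer_rate\<close> has
  derivative \<open>artanh\<close>, this says that it is convex in \<open>x\<^sup>2\<close>.
\<close>
lemma artanh_slope_mono:
  fixes x y :: real
  assumes "0 < x" "x \<le> y" "y < 1"
  shows "artanh x / x \<le> artanh y / y"
proof -
  have "convex_on {0..<1} (artanh :: real \<Rightarrow> real)"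
  proof (rule convex_on_realI[where f' = "\<lambda>x. 1 / (1 - x\<^sup>2)"])
    show "(artanh has_real_derivative 1 / (1 - x\<^sup>2)) (at x)" if "x \<in> {0..<1}" for x :: real
      using that by (intro artanh_real_has_field_derivative) auto
    show "1 / (1 - x\<^sup>2) \<le> 1 / (1 - y\<^sup>2)"
      if "x \<in> {0..<1}" "y \<in> {0..<1}" "x \<le> y" for x y :: real
      using that by (intro divide_left_mono) (auto simp: power_mono abs_square_less_1 mult_pos_pos)
  qed auto
  from convex_onD[OF this, of "x / y" 0 y] show ?thesis
    using assms by (simp add: field_simps)
qed

lemma cramer_rate_ge_tangent_parabola_pos:
  assumes p: "0 < p" "p < 1" and m: "0 \<le> m" "m \<le> 1"
  shows "cramer_rate m - artanh p / (2 * p) * m\<^sup>2 \<ge> cramer_rate p - artanh p / (2 * p) * p\<^sup>2"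
proof -
  define b where "b = artanh p / p"
  define G where "G = (\<lambda>m. cramer_rate m - b / 2 * m\<^sup>2)"
  have G_deriv: "(G has_real_derivative artanh t - b * t) (at t)" if "0 < t" "t < 1" for t
    unfolding G_def using that
    by (auto intro!: derivative_eq_intros cramer_rate_has_real_derivative)
  have G_cont: "continuous_on {u..v} G" if "0 \<le> u" "v \<le> 1" for u v
    unfolding G_def using that
    by (intro continuous_intros continuous_on_subset[OF continuous_on_cramer_rate]) auto
  have "G p \<le> G m"
  proof (cases "m \<le> p")
    case True
    show ?thesis
    proof (rule DERIV_nonpos_imp_decreasing_open[OF True])
      fix t assume t: "m < t" "t < p"
      have "artanh t - b * t \<le> 0"
        using artanh_slope_mono[of t p] t p m by (simp add: b_def field_simps)
      with G_deriv[of t] t p m show "\<exists>y. DERIV G t :> y \<and> y \<le> 0" by auto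
    qed (use p m G_cont in auto)
  next
    case False
    then have "p \<le> m" by simp
    then show ?thesis
    proof (rule DERIV_nonneg_imp_increasing_open)
      fix t assume t: "p < t" "t < m"
      have "artanh t - b * t \<ge> 0"
        using artanh_slope_mono[of p t] t p m by (simp add: b_def field_simps)
      with G_deriv[of t] t p m show "\<exists>y. DERIV G t :> y \<and> 0 \<le> y" by auto
    qed (use p m G_cont in auto)
  qed
  then show ?thesis by (simp add: G_def b_def)
qed

text \<open>
  In the variable \<open>m\<^sup>2\<close> the right-hand side is the tangent at \<open>p\<^sup>2\<close>.  Both sides are even in \<open>m\<close> and
  in \<open>p\<close>, which reduces the claim to positive arguments.
\<close>
lemma cramer_rate_ge_tangent_parabola:
  assumes p: "p \<noteq> 0" "\<bar>p\<bar> < 1" and m: "\<bar>m\<bar> \<le> 1"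
  shows "cramer_rate m \<ge> cramer_rate p + artanh p / (2 * p) * (m\<^sup>2 - p\<^sup>2)"
proof -
  have abs_rate: "cramer_rate \<bar>t\<bar> = cramer_rate t" for t
    by (simp add: abs_if)
  have "artanh \<bar>p\<bar> / (2 * \<bar>p\<bar>) = artanh p / (2 * p)"
    using p by (auto simp: abs_if)
  with cramer_rate_ge_tangent_parabola_pos[of "\<bar>p\<bar>" "\<bar>m\<bar>"] p m show ?thesis
    by (simp add: abs_rate right_diff_distrib)
qed

section \<open>The minimum of the free energy\<close>

text \<open>
  The mean-field equation turns the tangent parabola into the quadratic lower bound: its linear
  coefficient \<open>- \<beta> * h\<close> is \<open>- 2 * c * p\<close>, so the terms of degree at most two complete to a square.
\<close>
lemma free_energy_ge_quadratic:
  assumes p: "p \<noteq> 0" "\<bar>p\<bar> < 1" and eq: "artanh p = \<beta> * (p + h)" and m: "\<bar>m\<bar> \<le> 1"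
  shows "free_energy \<beta> h m \<ge> free_energy \<beta> h p + \<beta> * h / (2 * p) * (m - p)\<^sup>2"
proof -
  have "artanh p / (2 * p) * (m\<^sup>2 - p\<^sup>2) - (\<beta> * m\<^sup>2 / 2 + \<beta> * h * m)
      = \<beta> * h / (2 * p) * (m - p)\<^sup>2 - (\<beta> * p\<^sup>2 / 2 + \<beta> * h * p)"
    using p unfolding eq by (simp add: field_simps power2_eq_square)
  with cramer_rate_ge_tangent_parabola[OF p m] show ?thesis
    unfolding free_energy_eq_cramer_rate by linarith
qed

lemma mean_field_solution_pos:
  fixes \<beta> h :: real
  assumes "\<beta> > 0" "h > 0"
  obtains p where "0 < p" "p < 1" "artanh p = \<beta> * (p + h)"
proof -
  define g where "g = (\<lambda>t. t - tanh (\<beta> * (t + h)))"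
  have "g 0 \<le> 0" "0 \<le> g 1"
    using assms tanh_real_lt_1[of "\<beta> * (1 + h)"] by (auto simp: g_def)
  moreover have "continuous_on {0..1} g"
    unfolding g_def by (intro continuous_intros) (auto simp: cosh_real_nonzero)
  ultimately obtain p where "0 \<le> p" "g p = 0"
    using IVT'[of g 0 0 1] by auto
  then have p: "p = tanh (\<beta> * (p + h))" by (simp add: g_def)
  moreover have "\<beta> * (p + h) > 0" using \<open>0 \<le> p\<close> assms by simp
  ultimately have "0 < p" "p < 1"
    using tanh_real_lt_1[of "\<beta> * (p + h)"] by (metis tanh_real_pos_iff, metis)
  moreover have "artanh p = \<beta> * (p + h)"
    using p artanh_tanh_real by metis
  ultimately show thesis using that by blast
qed

text \<open>
  The mean-field equation may have further solutions, of the sign opposite to \<open>h\<close>; the condition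
  \<open>h / p > 0\<close> excludes them and makes the coefficient in \<open>free_energy_ge_quadratic\<close> positive.
\<close>
lemma mean_field_solution:
  fixes \<beta> h :: real
  assumes "\<beta> > 0" "h \<noteq> 0"
  obtains p where "\<bar>p\<bar> < 1" "h / p > 0" "artanh p = \<beta> * (p + h)"
proof (cases "h > 0")
  case True
  then obtain p where "0 < p" "p < 1" "artanh p = \<beta> * (p + h)"
    using mean_field_solution_pos assms by blast
  with True that[of p] show thesis by auto
next
  case False
  then have "- h > 0" using assms by simp
  then obtain p where "0 < p" "p < 1" "artanh p = \<beta> * (p + - h)"
    using mean_field_solution_pos assms by blast
  with \<open>- h > 0\<close> that[of "- p"] show thesis by (auto simp: field_simps)
qed

lemma m0_properties:
  assumes "\<beta> > 0" "h \<noteq> 0"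
  shows "\<bar>m0 \<beta> h\<bar> < 1" "h / m0 \<beta> h > 0" "artanh (m0 \<beta> h) = \<beta> * (m0 \<beta> h + h)"
proof -
  obtain p where p: "\<bar>p\<bar> < 1" "h / p > 0" "artanh p = \<beta> * (p + h)"
    using mean_field_solution assms by blast
  then have "p \<noteq> 0" by auto
  have gt: "free_energy \<beta> h m > free_energy \<beta> h p" if "m \<in> {-1<..<1}" "m \<noteq> p" for m
  proof -
    have "\<beta> * (h / p) * (m - p)\<^sup>2 / 2 > 0"
      using p(2) that(2) assms(1) by (intro half_gt_zero mult_pos_pos) auto
    then show ?thesis
      using free_energy_ge_quadratic[OF \<open>p \<noteq> 0\<close> p(1,3), of m] that
      by (simp add: abs_le_iff mult.commute)
  qed
  have "m0 \<beta> h = p"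
    unfolding m0_def
  proof (rule the_equality)
    show "is_arg_min (free_energy \<beta> h) (\<lambda>m. m \<in> {-1<..<1}) p"
      using p(1) gt by (force simp: is_arg_min_def)
    show "m = p" if "is_arg_min (free_energy \<beta> h) (\<lambda>m. m \<in> {-1<..<1}) m" for m
      using that p(1) gt[of m] by (force simp: is_arg_min_def)
  qed
  with p show "\<bar>m0 \<beta> h\<bar> < 1" "h / m0 \<beta> h > 0" "artanh (m0 \<beta> h) = \<beta> * (m0 \<beta> h + h)"
    by simp_all
qed

section \<open>Comparison with independent biased coins\<close>

text \<open>For \<open>\<bar>t\<bar> \<le> 1\<close> this is the density of \<open>n\<close> independent \<open>\<plusminus>1\<close> spins with mean \<open>t\<close>.\<close>
definition coin_weight :: "real \<Rightarrow> nat \<Rightarrow> (nat \<Rightarrow> real) \<Rightarrow> real" where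
  "coin_weight t n x = (\<Prod>i = 1..n. (1 + t * x i) / 2)"

lemma spin_cases:
  assumes "x \<in> spin_configs n" "i \<in> {1..n}"
  shows "x i = 1 \<or> x i = -1"
  using assms unfolding spin_configs_def by auto

lemma sum_coin_weight: "(\<Sum>x\<in>spin_configs n. coin_weight t n x) = 1"
proof -
  have "(\<Sum>x\<in>spin_configs n. coin_weight t n x)
      = (\<Prod>i\<in>{1..n}. \<Sum>s\<in>{-1, 1}. (1 + t * s) / 2)"
    unfolding spin_configs_def coin_weight_def by (rule prod_sum_PiE[symmetric]) auto
  also have "\<dots> = 1" by (simp add: field_simps)
  finally show ?thesis .
qed

lemma coin_weight_nonneg:
  assumes "x \<in> spin_configs n" "\<bar>t\<bar> \<le> 1"
  shows "coin_weight t n x \<ge> 0"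
  unfolding coin_weight_def
proof (rule prod_nonneg)
  fix i assume "i \<in> {1..n}"
  with spin_cases[OF assms(1)] assms(2) show "(1 + t * x i) / 2 \<ge> 0" by fastforce
qed

lemma sum_spins_eq:
  assumes "n \<ge> 1"
  shows "(\<Sum>i = 1..n. x i) = real n * magnetization n x"
  using assms by (simp add: magnetization_def)

lemma coin_weight_eq_exp:
  assumes x: "x \<in> spin_configs n" and n: "n \<ge> 1"
    and pos: "\<And>i. i \<in> {1..n} \<Longrightarrow> 1 + t * x i > 0"
  shows "coin_weight t n x = exp (real n * ((1 + magnetization n x) / 2 * ln (1 + t)
           + (1 - magnetization n x) / 2 * ln (1 - t))) / 2 ^ n"
proof -
  have "coin_weight t n x = (\<Prod>i = 1..n. exp (ln (1 + t * x i))) / 2 ^ n"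
    unfolding coin_weight_def by (simp add: prod_dividef pos)
  also have "(\<Prod>i = 1..n. exp (ln (1 + t * x i))) = exp (\<Sum>i = 1..n. ln (1 + t * x i))"
    by (simp add: exp_sum)
  \<comment> \<open>A function on \<open>{-1, 1}\<close> is affine, so the sum depends on the magnetization only.\<close>
  also have "(\<Sum>i = 1..n. ln (1 + t * x i))
      = (\<Sum>i = 1..n. (ln (1 + t) + ln (1 - t)) / 2 + (ln (1 + t) - ln (1 - t)) / 2 * x i)"
  proof (rule sum.cong[OF refl])
    fix i assume "i \<in> {1..n}"
    from spin_cases[OF x this]
    show "ln (1 + t * x i) = (ln (1 + t) + ln (1 - t)) / 2 + (ln (1 + t) - ln (1 - t)) / 2 * x i"
      by (auto simp: field_simps)
  qed
  also have "\<dots> = real n * ((ln (1 + t) + ln (1 - t)) / 2)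
      + (ln (1 + t) - ln (1 - t)) / 2 * (real n * magnetization n x)"
    unfolding sum.distrib sum_distrib_left[symmetric] sum_spins_eq[OF n, of x] by simp
  also have "\<dots> = real n * ((1 + magnetization n x) / 2 * ln (1 + t)
      + (1 - magnetization n x) / 2 * ln (1 - t))"
    by (simp add: field_simps)
  finally show ?thesis .
qed

text \<open>
  Averaging \<open>1 + x j * x i\<close> over \<open>j\<close> gives a positive number because of the term \<open>j = i\<close>.  So no
  factor of \<open>coin_weight m n x\<close> vanishes when \<open>m\<close> is the magnetization of \<open>x\<close>, not even for the
  degenerate coins \<open>m = 1\<close> and \<open>m = -1\<close>.
\<close>
lemma one_plus_magnetization_mult_spin_pos:
  assumes x: "x \<in> spin_configs n" and i: "i \<in> {1..n}"
  shows "1 + magnetization n x * x i > 0"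
proof -
  have n: "n \<ge> 1" using i by simp
  have "0 < (1 + x i * x i)"
    by (smt (verit) zero_le_square)
  also have "\<dots> \<le> (\<Sum>j = 1..n. 1 + x j * x i)"
  proof (rule member_le_sum[OF i, where f = "\<lambda>j. 1 + x j * x i"])
    fix j assume "j \<in> {1..n} - {i}"
    with spin_cases[OF x, of j] spin_cases[OF x i] show "0 \<le> 1 + x j * x i" by auto
  qed auto
  also have "\<dots> = real n * (1 + magnetization n x * x i)"
    unfolding sum.distrib sum_distrib_right[symmetric] sum_spins_eq[OF n, of x]
    by (simp add: algebra_simps)
  finally show ?thesis using n by (simp add: zero_less_mult_iff)
qed

lemma abs_magnetization_le_1:
  assumes x: "x \<in> spin_configs n"
  shows "\<bar>magnetization n x\<bar> \<le> 1"
proof (cases "n = 0")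
  case False
  have "\<bar>\<Sum>i = 1..n. x i\<bar> \<le> (\<Sum>i = 1..n. \<bar>x i\<bar>)" by (rule sum_abs)
  also have "\<dots> = (\<Sum>i = 1..n. 1)"
    using spin_cases[OF x] by (intro sum.cong) force+
  finally show ?thesis using False by (simp add: magnetization_def field_simps)
qed (simp add: magnetization_def)

lemma card_magnetizations_le: "card (magnetization n ` spin_configs n) \<le> n + 1"
proof -
  have "magnetization n ` spin_configs n \<subseteq> (\<lambda>k. 1 / real n * (2 * real k - real n)) ` {..n}"
  proof
    fix m assume "m \<in> magnetization n ` spin_configs n"
    then obtain x where x: "x \<in> spin_configs n" and m: "m = magnetization n x" by blast
    define P where "P = {i \<in> {1..n}. x i = 1}"
    have "(\<Sum>i = 1..n. x i) = (\<Sum>i = 1..n. 2 * (if x i = 1 then 1 else 0) - 1)"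
      using spin_cases[OF x] by (intro sum.cong) force+
    also have "\<dots> = 2 * real (card P) - real n"
      by (simp add: sum_subtractf sum_distrib_left[symmetric] P_def sum.If_cases Int_def)
    finally have "m = 1 / real n * (2 * real (card P) - real n)"
      by (simp add: m magnetization_def)
    moreover have "card P \<le> n"
      using card_mono[of "{1..n}" P] unfolding P_def by fastforce
    ultimately show "m \<in> (\<lambda>k. 1 / real n * (2 * real k - real n)) ` {..n}" by blast
  qed
  then have "card (magnetization n ` spin_configs n) \<le> card {..n}"
    by (rule surj_card_le[rotated]) simp
  then show ?thesis by simp
qed

lemma boltzmann_exponent:
  "- \<beta> * hamiltonian h n x
    = real n * (\<beta> * (magnetization n x)\<^sup>2 / 2 + \<beta> * h * magnetization n x)"
  by (simp add: hamiltonian_def algebra_simps)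

text \<open>The entropy of the coin whose mean is the magnetization of \<open>x\<close> completes the energy of \<open>x\<close> to
  the free energy.\<close>
lemma boltzmann_weight_eq_coin_weight:
  assumes x: "x \<in> spin_configs n" and n: "n \<ge> 1"
  defines "m \<equiv> magnetization n x"
  shows "exp (- \<beta> * hamiltonian h n x)
      = 2 ^ n * exp (- real n * free_energy \<beta> h m) * coin_weight m n x"
proof -
  have "coin_weight m n x = exp (real n * cramer_rate m) / 2 ^ n"
    unfolding m_def
    using coin_weight_eq_exp[OF x n one_plus_magnetization_mult_spin_pos[OF x]]
    by (simp add: cramer_rate_def add.commute)
  then show ?thesis
    unfolding boltzmann_exponent m_def[symmetric] free_energy_eq_cramer_rate
    by (simp add: exp_add[symmetric] algebra_simps)
qed

text \<open>
  At a solution \<open>p\<close> of the mean-field equation, the logarithm of the right-hand side is affine in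
  the magnetization \<open>m\<close>: it is \<open>n\<close> times the tangent at \<open>p\<close> of \<open>\<beta> * m\<^sup>2 / 2 + \<beta> * h * m\<close>.
\<close>
lemma boltzmann_weight_ge_coin_weight:
  assumes x: "x \<in> spin_configs n" and n: "n \<ge> 1" and \<beta>: "\<beta> \<ge> 0"
    and p: "\<bar>p\<bar> < 1" and eq: "artanh p = \<beta> * (p + h)"
  shows "exp (- \<beta> * hamiltonian h n x)
      \<ge> 2 ^ n * exp (- real n * free_energy \<beta> h p) * coin_weight p n x"
proof -
  define m where "m = magnetization n x"
  define e where "e = (1 + m) / 2 * ln (1 + p) + (1 - m) / 2 * ln (1 - p)"
  have "coin_weight p n x = exp (real n * e) / 2 ^ n"
    unfolding e_def m_def
  proof (rule coin_weight_eq_exp[OF x n])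
    fix i assume "i \<in> {1..n}"
    from spin_cases[OF x this] p show "1 + p * x i > 0" by auto
  qed
  then have "2 ^ n * exp (- real n * free_energy \<beta> h p) * coin_weight p n x
      = exp (real n * (e - free_energy \<beta> h p))"
    by (simp add: exp_add[symmetric] algebra_simps)
  also have "e - free_energy \<beta> h p \<le> \<beta> * m\<^sup>2 / 2 + \<beta> * h * m"
  proof -
    have "e - cramer_rate p = (m - p) * artanh p"
      unfolding e_def cramer_rate_def artanh_eq_ln_diff[OF p] by (simp add: field_simps)
    then have "\<beta> * m\<^sup>2 / 2 + \<beta> * h * m - (e - free_energy \<beta> h p) = \<beta> * (m - p)\<^sup>2 / 2"
      unfolding free_energy_eq_cramer_rate eq by (simp add: field_simps power2_eq_square)
    moreover have "\<beta> * (m - p)\<^sup>2 / 2 \<ge> 0" using \<beta> by simp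
    ultimately show ?thesis by linarith
  qed
  finally show ?thesis
    unfolding boltzmann_exponent m_def by (simp add: mult_left_mono)
qed

lemma partition_function_ge:
  assumes n: "n \<ge> 1" and \<beta>: "\<beta> \<ge> 0" and p: "\<bar>p\<bar> < 1" and eq: "artanh p = \<beta> * (p + h)"
  shows "partition_function \<beta> h n \<ge> 2 ^ n * exp (- real n * free_energy \<beta> h p)"
proof -
  have "2 ^ n * exp (- real n * free_energy \<beta> h p)
      = (\<Sum>x\<in>spin_configs n. 2 ^ n * exp (- real n * free_energy \<beta> h p) * coin_weight p n x)"
    unfolding sum_distrib_left[symmetric] sum_coin_weight by simp
  also have "\<dots> \<le> partition_function \<beta> h n"
    unfolding partition_function_def
    by (intro sum_mono boltzmann_weight_ge_coin_weight assms)
  finally show ?thesis .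
qed

section \<open>Concentration of the magnetization\<close>

lemma measure_curie_weiss:
  assumes "A \<subseteq> spin_configs n"
  shows "measure (curie_weiss \<beta> h n) A
    = (\<Sum>x\<in>A. exp (- \<beta> * hamiltonian h n x)) / partition_function \<beta> h n"
proof -
  have "emeasure (curie_weiss \<beta> h n) A
      = (\<Sum>x\<in>A. ennreal (exp (- \<beta> * hamiltonian h n x) / partition_function \<beta> h n))"
    unfolding curie_weiss_def
    by (rule emeasure_point_measure_finite[OF finite_spin_configs assms])
  also have "\<dots> = ennreal (\<Sum>x\<in>A. exp (- \<beta> * hamiltonian h n x) / partition_function \<beta> h n)"
    by (rule sum_ennreal) (simp add: partition_function_pos less_imp_le)
  finally show ?thesis
    by (simp add: measure_def sum_divide_distrib sum_nonneg partition_function_pos less_imp_le)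
qed

lemma curie_weiss_concentration:
  assumes n: "n \<ge> 1" and \<beta>: "\<beta> > 0" and h: "h \<noteq> 0"
  defines "p \<equiv> m0 \<beta> h"
  shows "measure (curie_weiss \<beta> h n) {x \<in> spin_configs n. real n * (magnetization n x - p)\<^sup>2 \<ge> r}
    \<le> (real n + 1) * exp (- (\<beta> * h / (2 * p)) * r)"
proof -
  define c where "c = \<beta> * h / (2 * p)"
  define K where "K = 2 ^ n * exp (- real n * free_energy \<beta> h p)"
  define A where "A = {x \<in> spin_configs n. real n * (magnetization n x - p)\<^sup>2 \<ge> r}"
  define M where "M = magnetization n ` spin_configs n"
  note p = m0_properties[OF \<beta> h, folded p_def]
  then have "p \<noteq> 0" by auto
  have "c = \<beta> / 2 * (h / p)" by (simp add: c_def)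
  then have "c > 0" using \<beta> p(2) by (simp only: mult_pos_pos half_gt_zero)
  have "K > 0" by (simp add: K_def)
  have finM: "finite M" by (simp add: M_def finite_spin_configs)
  have coin_nonneg: "coin_weight t n x \<ge> 0" if "t \<in> M" "x \<in> spin_configs n" for t x
    using that abs_magnetization_le_1 by (auto simp: M_def intro!: coin_weight_nonneg)
  have weight_le: "exp (- \<beta> * hamiltonian h n x)
      \<le> K * exp (- c * r) * (\<Sum>t\<in>M. coin_weight t n x)" if "x \<in> A" for x
  proof -
    define m where "m = magnetization n x"
    have x: "x \<in> spin_configs n" and r: "r \<le> real n * (m - p)\<^sup>2"
      using that by (auto simp: A_def m_def)
    have m: "m \<in> M" "\<bar>m\<bar> \<le> 1"
      using x abs_magnetization_le_1 by (auto simp: M_def m_def)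
    have "c * r \<le> c * (real n * (m - p)\<^sup>2)"
      using r \<open>c > 0\<close> by (intro mult_left_mono) auto
    also have "\<dots> = real n * (c * (m - p)\<^sup>2)" by simp
    also have "\<dots> \<le> real n * (free_energy \<beta> h m - free_energy \<beta> h p)"
      using free_energy_ge_quadratic[OF \<open>p \<noteq> 0\<close> p(1,3) m(2)]
      by (intro mult_left_mono) (auto simp: c_def)
    finally have "- real n * free_energy \<beta> h m \<le> - real n * free_energy \<beta> h p + - c * r"
      by (simp add: algebra_simps)
    then have "2 ^ n * exp (- real n * free_energy \<beta> h m) \<le> K * exp (- c * r)"
      unfolding K_def by (simp add: exp_add[symmetric] mult.assoc)
    \<comment> \<open>Bounding by the sum over all of \<open>M\<close> makes the bound uniform in the coin \<open>m\<close> fitted to \<open>x\<close>.\<close>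
    moreover have "coin_weight m n x \<le> (\<Sum>t\<in>M. coin_weight t n x)"
      using m(1) finM coin_nonneg x by (intro member_le_sum) auto
    ultimately have "2 ^ n * exp (- real n * free_energy \<beta> h m) * coin_weight m n x
        \<le> K * exp (- c * r) * (\<Sum>t\<in>M. coin_weight t n x)"
      using coin_nonneg[OF m(1) x] \<open>K > 0\<close> by (elim mult_mono) auto
    then show ?thesis
      unfolding boltzmann_weight_eq_coin_weight[OF x n] m_def .
  qed
  have "(\<Sum>x\<in>A. exp (- \<beta> * hamiltonian h n x))
      \<le> (\<Sum>x\<in>A. K * exp (- c * r) * (\<Sum>t\<in>M. coin_weight t n x))"
    by (intro sum_mono weight_le)
  also have "\<dots> \<le> (\<Sum>x\<in>spin_configs n. K * exp (- c * r) * (\<Sum>t\<in>M. coin_weight t n x))"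
    using \<open>K > 0\<close> coin_nonneg
    by (intro sum_mono2 finite_spin_configs mult_nonneg_nonneg sum_nonneg) (auto simp: A_def)
  also have "\<dots> = K * exp (- c * r) * (\<Sum>t\<in>M. \<Sum>x\<in>spin_configs n. coin_weight t n x)"
    by (subst sum.swap) (simp add: sum_distrib_left)
  also have "\<dots> = exp (- c * r) * real (card M) * K"
    by (simp add: sum_coin_weight)
  also have "\<dots> \<le> exp (- c * r) * (real n + 1) * partition_function \<beta> h n"
  proof (intro mult_mono)
    show "real (card M) \<le> real n + 1"
      using card_magnetizations_le[of n] by (simp add: M_def)
    show "K \<le> partition_function \<beta> h n"
      unfolding K_def using n \<beta> p by (intro partition_function_ge) auto
  qed (use \<open>K > 0\<close> in auto)
  finally have "(\<Sum>x\<in>A. exp (- \<beta> * hamiltonian h n x)) / partition_function \<beta> h n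
      \<le> (real n + 1) * exp (- c * r)"
    using partition_function_pos[of \<beta> h n] by (simp add: divide_le_eq mult.commute)
  moreover have "measure (curie_weiss \<beta> h n) A
      = (\<Sum>x\<in>A. exp (- \<beta> * hamiltonian h n x)) / partition_function \<beta> h n"
    by (rule measure_curie_weiss) (auto simp: A_def)
  ultimately show ?thesis unfolding A_def c_def by simp
qed

theorem lemma5:
  fixes \<beta> h \<delta> \<alpha> :: real
  assumes "0 < \<delta>" and "\<delta> < 1 / 2"
    and "\<beta> > 1" and "h \<noteq> 0"
    and "\<alpha> > 0"
  shows "(\<lambda>n. real n powr \<alpha> *
            measure (curie_weiss \<beta> h n)
              {x \<in> spin_configs n. scaled_magnetization \<beta> h n x \<notin> F_set \<beta> h n \<delta>})
         \<longlonglongrightarrow> 0"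
proof -
  define p where "p = m0 \<beta> h"
  define c where "c = \<beta> * h / (2 * p)"
  define B where "B n = {x \<in> spin_configs n. scaled_magnetization \<beta> h n x \<notin> F_set \<beta> h n \<delta>}" for n
  define A where "A n = {x \<in> spin_configs n.
      real n * (magnetization n x - p)\<^sup>2 \<ge> (real n powr \<delta>)\<^sup>2}" for n
  have \<beta>: "\<beta> > 0" using assms by simp
  have "c = \<beta> / 2 * (h / p)" by (simp add: c_def)
  then have "c > 0"
    using \<beta> m0_properties(2)[OF \<beta> assms(4)] by (simp only: mult_pos_pos half_gt_zero p_def)
  have BA: "B n \<subseteq> A n" for n
  proof
    fix x assume "x \<in> B n"
    then have x: "x \<in> spin_configs n"
      and "real n powr \<delta> < \<bar>sqrt (real n) * (magnetization n x - p)\<bar>"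
      by (auto simp: B_def F_set_def scaled_values_def scaled_magnetization_def p_def)
    then have "(real n powr \<delta>)\<^sup>2 \<le> \<bar>sqrt (real n) * (magnetization n x - p)\<bar>\<^sup>2"
      by (intro power_mono) auto
    with x show "x \<in> A n" by (simp add: A_def power_mult_distrib)
  qed
  have "measure (curie_weiss \<beta> h n) (B n) \<le> (real n + 1) * exp (- c * (real n powr \<delta>)\<^sup>2)"
    if "n \<ge> 1" for n
  proof -
    interpret prob_space "curie_weiss \<beta> h n" by (rule prob_space_curie_weiss)
    have "measure (curie_weiss \<beta> h n) (B n) \<le> measure (curie_weiss \<beta> h n) (A n)"
      using BA by (intro finite_measure_mono)
        (auto simp: A_def curie_weiss_def sets_point_measure)
    also have "\<dots> \<le> (real n + 1) * exp (- c * (real n powr \<delta>)\<^sup>2)"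
      unfolding A_def c_def p_def by (rule curie_weiss_concentration[OF that \<beta> assms(4)])
    finally show ?thesis .
  qed
  then have "\<forall>\<^sub>F n in sequentially. real n powr \<alpha> * measure (curie_weiss \<beta> h n) (B n)
      \<le> real n powr \<alpha> * ((real n + 1) * exp (- c * (real n powr \<delta>)\<^sup>2))"
    by (intro eventually_sequentiallyI[of 1] mult_left_mono) auto
  moreover have "(\<lambda>n. real n powr \<alpha> * ((real n + 1) * exp (- c * (real n powr \<delta>)\<^sup>2)))
      \<longlonglongrightarrow> 0"
    using \<open>0 < \<delta>\<close> \<open>c > 0\<close> by real_asymp
  ultimately have "(\<lambda>n. real n powr \<alpha> * measure (curie_weiss \<beta> h n) (B n)) \<longlonglongrightarrow> 0"
    by (rule tendsto_sandwich[OF _ _ tendsto_const, rotated]) simp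
  then show ?thesis unfolding B_def .
qed

end
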